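(* Let $\Omega\subset\mathbb{R}^d$ be a bounded domain and let $$\mathcal{L}u=\sum_{i,j=1}^d a_{ij}(x)\frac{\partial^2u}{\partial x_i\partial x_j}+\sum_{i=1}^d b_i(x)\frac{\partial u}{\partial x_i}+c(x)u$$ be a second-order uniformly elliptic differential operator on $\Omega$ with $c\le 0$. Let $u$ be a solution of $$\mathcal{L}u=f\ \text{ on }\Omega,\qquad u=g\ \text{ on }\partial\Omega,$$ and let $\hat u$ be a solution of $$\mathcal{L}\hat u=f+\Delta f\ \text{ on }\Omega,\qquad \hat u=g+\Delta g\ \text{ on }\partial\Omega,$$ where $u,\hat u\in\mathcal{C}^2(\Omega)\cap\mathcal{C}^0(\overline{\Omega})$. Then $$\sup_{x\in\Omega}|u(x)-\hat u(x)|\le\sup_{x\in\partial\Omega}|\Delta g(x)|+\left(e^{(\beta+1)\operatorname{diam}(\Omega)}-1\right)\sup_{x\in\Omega}\left|\frac{\Delta f(x)}{\theta(x)}\right|,$$ where $\beta=\max_{1\le i\le d}\ \sup_{x\in\Omega}|b_i(x)/\theta(x)|$.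
   Context: The coefficients $a_{ij}, b_i, c$ are continuous real-valued functions on $\Omega$. The operator $\mathcal{L}$ is uniformly elliptic on $\Omega$ if there is a constant $\theta_0>0$ such that $\sum_{i,j=1}^d a_{ij}(x)\xi_i\xi_j\ge\theta_0\sum_{i=1}^d\xi_i^2$ for all $x\in\Omega$ and $\xi\in\mathbb{R}^d$. For $x\in\Omega$, $\theta(x)$ denotes the local ellipticity constant, i.e. the largest number with $\sum_{i,j=1}^d a_{ij}(x)\xi_i\xi_j\ge\theta(x)\sum_{i=1}^d\xi_i^2$ for all $\xi\in\mathbb{R}^d$ (so $\theta(x)\ge\theta_0>0$). The symbols $\Delta f$ and $\Delta g$ denote perturbation functions on $\Omega$ and $\partial\Omega$ respectively (not Laplacians). Suprema are taken in $[0,\infty]$, so the bound is vacuous when its right-hand side is infinite. $\overline{\Omega}$ is the closure of $\Omega$, and $\operatorname{diam}(\Omega)$ its diameter. *)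

theory Defs
  imports "HOL-Analysis.Analysis"
begin

definition partial :: "'n \<Rightarrow> (real^'n \<Rightarrow> real) \<Rightarrow> real^'n \<Rightarrow> real" where
  "partial i u x = deriv (\<lambda>t. u (x + t *\<^sub>R axis i 1)) 0"

definition has_partial_on :: "'n \<Rightarrow> (real^'n \<Rightarrow> real) \<Rightarrow> (real^'n) set \<Rightarrow> bool" where
  "has_partial_on i u S \<longleftrightarrow>
     (\<forall>x\<in>S. (\<lambda>t. u (x + t *\<^sub>R axis i 1)) field_differentiable (at 0))"

text \<open>Intended for open \<open>S\<close>: all partial derivatives of order at most 2 exist and are
  continuous on \<open>S\<close>.\<close>

definition C2_on :: "(real^'n) set \<Rightarrow> (real^'n \<Rightarrow> real) \<Rightarrow> bool" where
  "C2_on S u \<longleftrightarrow> continuous_on S u \<and>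
     (\<forall>i. has_partial_on i u S \<and> continuous_on S (partial i u)) \<and>
     (\<forall>i j. has_partial_on i (partial j u) S \<and> continuous_on S (partial i (partial j u)))"

definition elliptic_op ::
  "('n \<Rightarrow> 'n \<Rightarrow> real^'n \<Rightarrow> real) \<Rightarrow> ('n \<Rightarrow> real^'n \<Rightarrow> real) \<Rightarrow> (real^'n \<Rightarrow> real) \<Rightarrow>
    (real^'n \<Rightarrow> real) \<Rightarrow> real^'n \<Rightarrow> real" where
  "elliptic_op a b c u x =
     (\<Sum>i\<in>UNIV. \<Sum>j\<in>UNIV. a i j x * partial i (partial j u) x)
     + (\<Sum>i\<in>UNIV. b i x * partial i u x) + c x * u x"

definition uniformly_elliptic_on ::
  "(real^'n) set \<Rightarrow> ('n \<Rightarrow> 'n \<Rightarrow> real^'n \<Rightarrow> real) \<Rightarrow> bool" where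
  "uniformly_elliptic_on S a \<longleftrightarrow>
     (\<exists>\<theta>0>0. \<forall>x\<in>S. \<forall>\<xi>::real^'n.
        (\<Sum>i\<in>UNIV. \<Sum>j\<in>UNIV. a i j x * \<xi>$i * \<xi>$j) \<ge> \<theta>0 * (\<Sum>i\<in>UNIV. (\<xi>$i)\<^sup>2))"

definition ellipticity_const :: "('n \<Rightarrow> 'n \<Rightarrow> real^'n \<Rightarrow> real) \<Rightarrow> real^'n \<Rightarrow> real" where
  "ellipticity_const a x =
     (GREATEST \<theta>. \<forall>\<xi>::real^'n.
        (\<Sum>i\<in>UNIV. \<Sum>j\<in>UNIV. a i j x * \<xi>$i * \<xi>$j) \<ge> \<theta> * (\<Sum>i\<in>UNIV. (\<xi>$i)\<^sup>2))"

text \<open>The solutions are classical: \<open>C\<^sup>2\<close> in \<open>S\<close> and continuous up to the boundary.\<close>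

definition solves_dirichlet ::
  "(real^'n) set \<Rightarrow> ((real^'n \<Rightarrow> real) \<Rightarrow> real^'n \<Rightarrow> real) \<Rightarrow> (real^'n \<Rightarrow> real) \<Rightarrow>
    (real^'n \<Rightarrow> real) \<Rightarrow> (real^'n \<Rightarrow> real) \<Rightarrow> bool" where
  "solves_dirichlet S L f g u \<longleftrightarrow>
     C2_on S u \<and> continuous_on (closure S) u \<and>
     (\<forall>x\<in>S. L u x = f x) \<and> (\<forall>x\<in>frontier S. u x = g x)"

text \<open>The suprema below live in \<open>[0,\<infinity>]\<close>, so the exponential is extended by \<open>e\<^sup>\<infinity> = \<infinity>\<close>.\<close>

definition ennexp :: "ennreal \<Rightarrow> ennreal" where
  "ennexp t = (if t = \<infinity> then \<infinity> else ennreal (exp (enn2real t)))"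

definition drift_bound ::
  "(real^'n) set \<Rightarrow> ('n \<Rightarrow> 'n \<Rightarrow> real^'n \<Rightarrow> real) \<Rightarrow> ('n \<Rightarrow> real^'n \<Rightarrow> real) \<Rightarrow> ennreal" where
  "drift_bound S a b =
     (MAX i\<in>UNIV. SUP x\<in>S. ennreal \<bar>b i x / ellipticity_const a x\<bar>)"

end

theory Submission
  imports Defs
begin

text \<open>
  By linearity \<open>w = u' - u\<close> and \<open>- w\<close> satisfy the same kind of problem, with right-hand side
  \<open>\<plusminus>\<Delta>f\<close> and boundary values \<open>\<plusminus>\<Delta>g\<close>, so an upper bound for each of them is enough. Write
  \<open>H = sup \<bar>\<Delta>g\<bar>\<close>, \<open>F = sup \<bar>\<Delta>f / \<theta>\<bar>\<close>, \<open>D = diam \<Omega>\<close> and \<open>\<alpha> = \<beta> + 1\<close>.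

  The bound comes from the maximum principle and an explicit barrier. The function
  \<open>v x = H + F (e\<^bsup>\<alpha>D\<^esup> - e\<^bsup>\<alpha>(x\<^sub>k - s)\<^esup>)\<close>, where \<open>s\<close> is the least value of the coordinate \<open>x\<^sub>k\<close> on the
  closure of \<open>\<Omega>\<close>, dominates \<open>w\<close> on the boundary and satisfies \<open>\<L> v < - F \<theta> \<le> \<L> w\<close> inside, because
  its second derivative in direction \<open>k\<close> outweighs the drift. If \<open>w - v\<close> were positive somewhere, it
  would have a positive interior maximum, where \<open>\<L> (w - v) \<le> 0\<close>; this contradicts the strict
  inequality. Hence \<open>w \<le> v \<le> H + F (e\<^bsup>\<alpha>D\<^esup> - 1)\<close>. This is the lemma \<open>barrier_comparison\<close>.

  That \<open>\<L> h \<le> 0\<close> at a nonnegative interior maximum of \<open>h\<close> is the lemma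
  \<open>operator_nonpos_at_maximum\<close>. It rests on three facts: the Hessian is symmetric
  (\<open>mixed_axis_derivs_commute\<close>), it is negative semidefinite at the maximum
  (\<open>interior_maximum_conditions\<close>), and the trace of its product with a positive definite matrix is
  not positive (\<open>trace_product_nonpos\<close>).

  Two degenerate cases are hidden in the conventions for \<open>[0,\<infinity>]\<close>. For \<open>F = 0\<close> the barrier is not
  strict, and if also \<open>\<beta> = \<infinity>\<close> then \<open>\<infinity> \<cdot> 0 = 0\<close> still makes the claim \<open>w \<le> H\<close>. Both are covered by
  \<open>weak_maximum_principle\<close>: a continuous drift is bounded on the compact set where \<open>w \<ge> H + \<epsilon>\<close>, the only
  place where the barrier argument at level \<open>H + \<epsilon>\<close> uses the drift, and with a small positive
  constant instead of \<open>F\<close> that argument gives the bound up to \<open>2\<epsilon>\<close>.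
\<close>

section \<open>Functions with prescribed partial derivatives\<close>

text \<open>The partial derivatives of a function are carried along as explicit data rather than recovered
  with \<^const>\<open>deriv\<close>: sums and differences are then immediate, and the partials of an explicit
  comparison function can be written down directly. Partials are taken along the lines
  \<open>x + t e\<^sub>i\<close>, since that is the sense in which \<^const>\<open>C2_on\<close> provides them.\<close>

definition axis_derivs_on ::
  "(real^'n) set \<Rightarrow> (real^'n \<Rightarrow> real) \<Rightarrow> ('n \<Rightarrow> real^'n \<Rightarrow> real) \<Rightarrow> bool" where
  "axis_derivs_on S h p \<longleftrightarrow>
     (\<forall>x\<in>S. \<forall>i. ((\<lambda>t. h (x + t *\<^sub>R axis i 1)) has_real_derivative p i x) (at 0))"

text \<open>The index order follows \<^const>\<open>partial\<close>: \<open>q i j\<close> is \<open>\<partial>\<^sub>i\<partial>\<^sub>j h\<close>, the derivative of \<open>p j\<close> in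
  direction \<open>i\<close>.\<close>

definition c2_jet ::
  "(real^'n) set \<Rightarrow> (real^'n \<Rightarrow> real) \<Rightarrow> ('n \<Rightarrow> real^'n \<Rightarrow> real) \<Rightarrow>
    ('n \<Rightarrow> 'n \<Rightarrow> real^'n \<Rightarrow> real) \<Rightarrow> bool" where
  "c2_jet S h p q \<longleftrightarrow> axis_derivs_on S h p \<and> (\<forall>j. axis_derivs_on S (p j) (\<lambda>i. q i j)) \<and>
     (\<forall>i. continuous_on S (p i)) \<and> (\<forall>i j. continuous_on S (q i j))"

lemma c2_jet_of_C2_on:
  "C2_on S u \<Longrightarrow> c2_jet S u (\<lambda>i. partial i u) (\<lambda>i j. partial i (partial j u))"
  unfolding C2_on_def c2_jet_def axis_derivs_on_def has_partial_on_def
  by (simp add: partial_def DERIV_deriv_iff_field_differentiable)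

lemma c2_jet_diff:
  assumes "c2_jet S h p q" "c2_jet S h' p' q'"
  shows "c2_jet S (\<lambda>x. h x - h' x) (\<lambda>i x. p i x - p' i x) (\<lambda>i j x. q i j x - q' i j x)"
  using assms unfolding c2_jet_def axis_derivs_on_def
  by (auto intro!: DERIV_diff continuous_intros)

lemma axis_derivs_on_at:
  assumes "axis_derivs_on S h p" "x + s *\<^sub>R axis i 1 \<in> S"
  shows "((\<lambda>t. h (x + t *\<^sub>R axis i 1)) has_real_derivative p i (x + s *\<^sub>R axis i 1)) (at s)"
proof -
  have "((\<lambda>t. h ((x + s *\<^sub>R axis i 1) + t *\<^sub>R axis i 1)) has_real_derivative
          p i (x + s *\<^sub>R axis i 1)) (at 0)"
    using assms unfolding axis_derivs_on_def by blast
  then have "((\<lambda>t. h (x + (t + s) *\<^sub>R axis i 1)) has_real_derivative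
          p i (x + s *\<^sub>R axis i 1)) (at 0)"
    by (simp add: algebra_simps)
  then show ?thesis
    using DERIV_shift[of "\<lambda>t. h (x + t *\<^sub>R axis i 1)" _ 0 s] by simp
qed

lemma axis_mvt:
  assumes "axis_derivs_on S h p"
    and seg: "\<And>r. 0 \<le> r \<Longrightarrow> r \<le> 1 \<Longrightarrow> x + (r * s) *\<^sub>R axis i 1 \<in> S"
  obtains r where "0 < r" "r < 1"
    "h (x + s *\<^sub>R axis i 1) - h x = s * p i (x + (r * s) *\<^sub>R axis i 1)"
proof -
  let ?g = "\<lambda>r. h (x + (r * s) *\<^sub>R axis i 1)"
  have d: "(?g has_real_derivative s * p i (x + (r * s) *\<^sub>R axis i 1)) (at r)"
    if "0 \<le> r" "r \<le> 1" for r
  proof -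
    have m: "((\<lambda>r. r * s) has_real_derivative s) (at r)"
      by (auto intro!: derivative_eq_intros)
    show ?thesis
      using DERIV_chain2[OF axis_derivs_on_at[OF assms(1) seg[OF that]] m]
      by (simp add: mult.commute)
  qed
  have "\<exists>r>0. r < 1 \<and> ?g 1 - ?g 0 = (1 - 0) * (s * p i (x + (r * s) *\<^sub>R axis i 1))"
    by (rule MVT2[of 0 1 ?g]) (use d in auto)
  then show thesis
    using that by auto
qed

text \<open>The classical telescoping argument: the increment from \<open>x\<close> to \<open>x + \<xi>\<close> is split into moves that
  change one coordinate at a time. By the mean value theorem each move contributes \<open>\<xi>\<^sub>i\<close> times
  \<open>\<partial>\<^sub>i h\<close> at a point close to \<open>x\<close>, where continuity makes it close to \<open>\<partial>\<^sub>i h x\<close>.\<close>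

lemma has_derivative_of_axis_derivs:
  fixes h :: "real^'n \<Rightarrow> real"
  assumes "open S" "x \<in> S" and h: "axis_derivs_on S h p"
    and p: "\<And>i. continuous_on S (p i)"
  shows "(h has_derivative (\<lambda>\<xi>. \<Sum>i\<in>UNIV. \<xi>$i * p i x)) (at x)"
  unfolding has_derivative_at_alt
proof (intro conjI allI impI)
  have "linear (\<lambda>\<xi>::real^'n. \<Sum>i\<in>UNIV. \<xi>$i * p i x)"
    by (rule linearI) (simp_all add: sum.distrib algebra_simps sum_distrib_left)
  then show "bounded_linear (\<lambda>\<xi>::real^'n. \<Sum>i\<in>UNIV. \<xi>$i * p i x)"
    by (rule linear_conv_bounded_linear[THEN iffD1])
  fix e :: real assume "e > 0"
  define e' where "e' = e / real CARD('n)"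
  have "e' > 0" using \<open>e > 0\<close> by (simp add: e'_def)
  obtain d0 where d0: "d0 > 0" "ball x d0 \<subseteq> S"
    using assms(1,2) openE by blast
  have "\<forall>i. \<exists>d>0. \<forall>y. dist y x < d \<longrightarrow> \<bar>p i y - p i x\<bar> < e'"
  proof
    fix i
    have "continuous (at x) (p i)"
      using p assms(1,2) continuous_on_eq_continuous_at by blast
    then show "\<exists>d>0. \<forall>y. dist y x < d \<longrightarrow> \<bar>p i y - p i x\<bar> < e'"
      using \<open>e' > 0\<close> unfolding continuous_at_eps_delta by (metis dist_real_def)
  qed
  then obtain d where d: "\<And>i. d i > 0" "\<And>i y. dist y x < d i \<Longrightarrow> \<bar>p i y - p i x\<bar> < e'"
    by metis
  define \<delta> where "\<delta> = min d0 (Min (range d))"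
  have "\<delta> > 0" using d0 d(1) by (simp add: \<delta>_def)
  have close: "\<bar>p i y - p i x\<bar> \<le> e'" "y \<in> S" if "dist y x < \<delta>" for i y
  proof -
    have "Min (range d) \<le> d i" by simp
    then have "dist y x < d i" "dist y x < d0" using that unfolding \<delta>_def by linarith+
    then show "\<bar>p i y - p i x\<bar> \<le> e'" "y \<in> S" using d(2) d0 less_imp_le
      by (blast, auto simp: dist_commute)
  qed
  show "\<exists>\<delta>>0. \<forall>y. norm (y - x) < \<delta> \<longrightarrow>
      norm (h y - h x - (\<Sum>i\<in>UNIV. (y - x)$i * p i x)) \<le> e * norm (y - x)"
  proof (intro exI[of _ \<delta>] conjI allI impI \<open>\<delta> > 0\<close>)
    fix y assume "norm (y - x) < \<delta>"
    define \<xi> where "\<xi> = y - x"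
    have n\<xi>: "norm \<xi> < \<delta>" using \<open>norm (y - x) < \<delta>\<close> by (simp add: \<xi>_def)
    \<comment> \<open>The part of the displacement that uses only the coordinates in \<open>T\<close>; the induction adds
      them one by one.\<close>
    define P where "P T = (\<chi> i. if i \<in> T then \<xi>$i else 0)" for T
    have "\<bar>h (x + P T) - h x - (\<Sum>i\<in>T. \<xi>$i * p i x)\<bar> \<le> e' * (\<Sum>i\<in>T. \<bar>\<xi>$i\<bar>)" for T
    proof (induction T rule: finite_induct[OF finite])
      case 1
      have "P {} = 0" by (simp add: P_def vec_eq_iff)
      then show ?case by simp
    next
      case (2 k T)
      have P: "P (insert k T) = P T + \<xi>$k *\<^sub>R axis k 1"
        using 2 by (auto simp: P_def vec_eq_iff axis_def)
      have in_ball: "dist ((x + P T) + (r * \<xi>$k) *\<^sub>R axis k 1) x < \<delta>" if "0 \<le> r" "r \<le> 1" for r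
      proof -
        have "norm (P T + (r * \<xi>$k) *\<^sub>R axis k 1) \<le> norm \<xi>"
          by (rule norm_le_componentwise_cart)
            (use 2 that in \<open>auto simp: P_def axis_def abs_mult mult_left_le_one_le\<close>)
        then show ?thesis using n\<xi> by (simp add: dist_norm add.assoc)
      qed
      obtain r where r: "0 < r" "r < 1" and
        "h ((x + P T) + \<xi>$k *\<^sub>R axis k 1) - h (x + P T)
           = \<xi>$k * p k ((x + P T) + (r * \<xi>$k) *\<^sub>R axis k 1)"
        using axis_mvt[OF h, of "x + P T" "\<xi>$k" k] close(2)[OF in_ball] by blast
      then have eq: "h (x + P (insert k T)) - h (x + P T) - \<xi>$k * p k x
          = \<xi>$k * (p k ((x + P T) + (r * \<xi>$k) *\<^sub>R axis k 1) - p k x)"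
        by (simp add: P algebra_simps)
      have "\<bar>h (x + P (insert k T)) - h (x + P T) - \<xi>$k * p k x\<bar> \<le> \<bar>\<xi>$k\<bar> * e'"
        unfolding eq abs_mult using r by (intro mult_left_mono close in_ball) auto
      then show ?case using 2 by (simp add: algebra_simps)
    qed
    moreover have "P UNIV = \<xi>" "x + \<xi> = y" by (simp_all add: P_def \<xi>_def vec_eq_iff)
    ultimately have "\<bar>h y - h x - (\<Sum>i\<in>UNIV. \<xi>$i * p i x)\<bar> \<le> e' * (\<Sum>i\<in>UNIV. \<bar>\<xi>$i\<bar>)"
      by metis
    also have "\<dots> \<le> e' * (\<Sum>i\<in>(UNIV::'n set). norm \<xi>)"
      using \<open>e' > 0\<close> by (intro mult_left_mono sum_mono component_le_norm_cart) auto
    also have "\<dots> = e * norm \<xi>" by (simp add: e'_def)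
    finally show "norm (h y - h x - (\<Sum>i\<in>UNIV. (y - x)$i * p i x)) \<le> e * norm (y - x)"
      by (simp add: \<xi>_def)
  qed
qed

text \<open>Two mean value steps, first along \<open>e\<^sub>i\<close> for the difference \<open>y \<mapsto> h (y + s e\<^sub>j) - h y\<close>, then along
  \<open>e\<^sub>j\<close> for \<open>\<partial>\<^sub>i h\<close>. The left-hand side is symmetric in \<open>i\<close> and \<open>j\<close>, which is how the symmetry of
  the second derivatives will arise.\<close>

lemma second_difference_mvt:
  assumes "axis_derivs_on S h p" and "axis_derivs_on S (p i) (\<lambda>j. q j i)"
    and "\<And>\<sigma> \<tau>. 0 \<le> \<sigma> \<Longrightarrow> \<sigma> \<le> 1 \<Longrightarrow> 0 \<le> \<tau> \<Longrightarrow> \<tau> \<le> 1 \<Longrightarrow>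
      x + (\<sigma> * s) *\<^sub>R axis i 1 + (\<tau> * s) *\<^sub>R axis j 1 \<in> S"
  obtains \<sigma> \<tau> where "0 < \<sigma>" "\<sigma> < 1" "0 < \<tau>" "\<tau> < 1"
    "h (x + s *\<^sub>R axis i 1 + s *\<^sub>R axis j 1) - h (x + s *\<^sub>R axis i 1) - h (x + s *\<^sub>R axis j 1) + h x
      = s * s * q j i (x + (\<sigma> * s) *\<^sub>R axis i 1 + (\<tau> * s) *\<^sub>R axis j 1)"
proof -
  let ?S' = "{y. y \<in> S \<and> y + s *\<^sub>R axis j 1 \<in> S}"
  let ?k = "\<lambda>y. h (y + s *\<^sub>R axis j 1) - h y"
  have "axis_derivs_on ?S' ?k (\<lambda>i y. p i (y + s *\<^sub>R axis j 1) - p i y)"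
    using assms(1) unfolding axis_derivs_on_def
    by (auto intro!: DERIV_diff simp: add.assoc add.commute[of _ "s *\<^sub>R axis j 1"])
  moreover have "x + (r * s) *\<^sub>R axis i 1 \<in> ?S'" if "0 \<le> r" "r \<le> 1" for r
    using assms(3)[OF that, of 0] assms(3)[OF that, of 1] by simp
  ultimately obtain \<sigma> where \<sigma>: "0 < \<sigma>" "\<sigma> < 1" "?k (x + s *\<^sub>R axis i 1) - ?k x =
      s * (p i (x + (\<sigma> * s) *\<^sub>R axis i 1 + s *\<^sub>R axis j 1) - p i (x + (\<sigma> * s) *\<^sub>R axis i 1))"
    by (rule axis_mvt)
  obtain \<tau> where \<tau>: "0 < \<tau>" "\<tau> < 1"
    "p i (x + (\<sigma> * s) *\<^sub>R axis i 1 + s *\<^sub>R axis j 1) - p i (x + (\<sigma> * s) *\<^sub>R axis i 1)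
      = s * q j i (x + (\<sigma> * s) *\<^sub>R axis i 1 + (\<tau> * s) *\<^sub>R axis j 1)"
    using axis_mvt[OF assms(2), of "x + (\<sigma> * s) *\<^sub>R axis i 1" s j] assms(3) \<sigma>
    by (metis less_imp_le)
  show thesis
    by (rule that[of \<sigma> \<tau>]) (use \<sigma> \<tau> in auto)
qed

text \<open>Both mixed partials equal the same second difference divided by \<open>s\<^sup>2\<close>, at points that tend to
  \<open>x\<close> with \<open>s\<close>; continuity does the rest.\<close>

lemma mixed_axis_derivs_commute:
  assumes "open S" "x \<in> S" and jet: "c2_jet S h p q"
  shows "q i j x = q j i x"
proof -
  have h: "axis_derivs_on S h p" and p: "\<And>j. axis_derivs_on S (p j) (\<lambda>i. q i j)"
    and q: "\<And>i j. continuous_on S (q i j)"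
    using jet by (simp_all add: c2_jet_def)
  have bound: "\<bar>q i j x - q j i x\<bar> \<le> 2 * e" if "e > 0" for e
  proof -
    obtain d0 where d0: "d0 > 0" "ball x d0 \<subseteq> S"
      using assms(1,2) openE by blast
    have "\<exists>d>0. \<forall>y. dist y x < d \<longrightarrow> \<bar>q i j y - q i j x\<bar> < e" for i j
    proof -
      have "continuous (at x) (q i j)"
        using q assms(1,2) continuous_on_eq_continuous_at by blast
      then show ?thesis
        using \<open>e > 0\<close> unfolding continuous_at_eps_delta by (metis dist_real_def)
    qed
    then obtain d1 d2 where d1: "d1 > 0" "\<And>y. dist y x < d1 \<Longrightarrow> \<bar>q i j y - q i j x\<bar> < e"
      and d2: "d2 > 0" "\<And>y. dist y x < d2 \<Longrightarrow> \<bar>q j i y - q j i x\<bar> < e"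
      by meson
    \<comment> \<open>The points of the square are within \<open>2s\<close> of \<open>x\<close>, so a third of the admissible radius is enough.\<close>
    define s where "s = min d0 (min d1 d2) / 3"
    have "s > 0" using d0 d1 d2 by (simp add: s_def)
    have near: "dist (x + (\<sigma> * s) *\<^sub>R axis k 1 + (\<tau> * s) *\<^sub>R axis l 1) x < min d0 (min d1 d2)"
      if "0 \<le> \<sigma>" "\<sigma> \<le> 1" "0 \<le> \<tau>" "\<tau> \<le> 1" for \<sigma> \<tau> k l
    proof -
      have "norm ((\<sigma> * s) *\<^sub>R axis k 1 + (\<tau> * s) *\<^sub>R axis l (1::real)) \<le> \<sigma> * s + \<tau> * s"
        using that \<open>s > 0\<close> by (intro norm_triangle_le) (simp add: norm_axis_1)
      also have "\<dots> \<le> 1 * s + 1 * s"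
        using that \<open>s > 0\<close> by (intro add_mono mult_right_mono) auto
      also have "\<dots> < min d0 (min d1 d2)"
      proof -
        have "3 * s = min d0 (min d1 d2)" by (simp add: s_def)
        then show ?thesis using \<open>s > 0\<close> by linarith
      qed
      finally show ?thesis by (simp add: dist_norm add.assoc)
    qed
    have inS: "x + (\<sigma> * s) *\<^sub>R axis k 1 + (\<tau> * s) *\<^sub>R axis l 1 \<in> S"
      if "0 \<le> \<sigma>" "\<sigma> \<le> 1" "0 \<le> \<tau>" "\<tau> \<le> 1" for \<sigma> \<tau> k l
      using near[OF that, of k l] d0 by (auto simp: dist_commute)
    obtain \<sigma> \<tau> where 1: "0 < \<sigma>" "\<sigma> < 1" "0 < \<tau>" "\<tau> < 1"
      "h (x + s *\<^sub>R axis i 1 + s *\<^sub>R axis j 1) - h (x + s *\<^sub>R axis i 1) - h (x + s *\<^sub>R axis j 1) + h x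
      = s * s * q j i (x + (\<sigma> * s) *\<^sub>R axis i 1 + (\<tau> * s) *\<^sub>R axis j 1)"
      using second_difference_mvt[of S h p i q x s j, OF h p inS] by blast
    obtain \<sigma>' \<tau>' where 2: "0 < \<sigma>'" "\<sigma>' < 1" "0 < \<tau>'" "\<tau>' < 1"
      "h (x + s *\<^sub>R axis j 1 + s *\<^sub>R axis i 1) - h (x + s *\<^sub>R axis j 1) - h (x + s *\<^sub>R axis i 1) + h x
      = s * s * q i j (x + (\<sigma>' * s) *\<^sub>R axis j 1 + (\<tau>' * s) *\<^sub>R axis i 1)"
      using second_difference_mvt[of S h p j q x s i, OF h p inS] by blast
    let ?y = "x + (\<sigma> * s) *\<^sub>R axis i 1 + (\<tau> * s) *\<^sub>R axis j 1"
    let ?z = "x + (\<sigma>' * s) *\<^sub>R axis j 1 + (\<tau>' * s) *\<^sub>R axis i 1"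
    have "x + s *\<^sub>R axis j 1 + s *\<^sub>R axis i 1 = x + s *\<^sub>R axis i 1 + s *\<^sub>R axis j 1"
      by (simp add: algebra_simps)
    then have "s * s * q j i ?y = s * s * q i j ?z"
      using 1(5) 2(5) by (simp only:)
    then have "q j i ?y = q i j ?z" using \<open>s > 0\<close> by simp
    moreover have "\<bar>q j i ?y - q j i x\<bar> < e"
      using near[of \<sigma> \<tau> i j] 1 by (intro d2) auto
    moreover have "\<bar>q i j ?z - q i j x\<bar> < e"
      using near[of \<sigma>' \<tau>' j i] 2 by (intro d1) auto
    ultimately show ?thesis by linarith
  qed
  from bound[of "\<bar>q i j x - q j i x\<bar> / 4"] show ?thesis
    by (cases "q i j x = q j i x") auto
qed

section \<open>Necessary conditions at an interior maximum\<close>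

text \<open>Restriction to a line through \<open>z\<close> reduces this to the one-dimensional necessary conditions for a
  maximum. Along \<open>z + t\<xi>\<close> the first derivative vanishes at \<open>t = 0\<close>; were the second one positive
  there, the function would increase for small \<open>t > 0\<close>.\<close>

lemma interior_maximum_conditions:
  fixes h :: "real^'n \<Rightarrow> real"
  assumes "open S" "z \<in> S" and jet: "c2_jet S h p q"
    and max: "\<And>y. y \<in> S \<Longrightarrow> h y \<le> h z"
  shows "p i z = 0" "(\<Sum>i\<in>UNIV. \<Sum>j\<in>UNIV. q i j z * \<xi> i * \<xi> j) \<le> 0"
proof -
  have h: "axis_derivs_on S h p" and p: "\<And>j. axis_derivs_on S (p j) (\<lambda>i. q i j)"
    and pc: "\<And>i. continuous_on S (p i)" and q: "\<And>i j. continuous_on S (q i j)"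
    using jet by (simp_all add: c2_jet_def)
  obtain d0 where d0: "d0 > 0" "ball z d0 \<subseteq> S"
    using assms(1,2) openE by blast
  show p0: "p i z = 0" for i
  proof (rule DERIV_local_max)
    show "((\<lambda>t. h (z + t *\<^sub>R axis i 1)) has_real_derivative p i z) (at 0)"
      using h \<open>z \<in> S\<close> unfolding axis_derivs_on_def by blast
    show "0 < d0" by fact
    show "\<forall>t. \<bar>0 - t\<bar> < d0 \<longrightarrow> h (z + t *\<^sub>R axis i 1) \<le> h (z + 0 *\<^sub>R axis i 1)"
      using d0 max by (force simp: dist_norm norm_axis_1 subset_iff)
  qed
  define v where "v = (\<chi> i. \<xi> i)"
  have line: "((\<lambda>t. z + t *\<^sub>R v) has_derivative (\<lambda>t. t *\<^sub>R v)) (at t)" for t :: real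
    by (auto intro!: derivative_eq_intros)
  have chain: "((\<lambda>t. k (z + t *\<^sub>R v)) has_real_derivative (\<Sum>i\<in>UNIV. \<xi> i * k' i (z + t *\<^sub>R v))) (at t)"
    if "axis_derivs_on S k k'" "\<And>i. continuous_on S (k' i)" "z + t *\<^sub>R v \<in> S" for k k' t
    using has_derivative_compose[OF line[of t] has_derivative_of_axis_derivs[OF assms(1) that(3,1,2)]]
    unfolding has_field_derivative_def
    by (rule has_derivative_eq_rhs) (auto simp: v_def sum_distrib_left mult_ac)
  define \<phi> where "\<phi> t = (\<Sum>j\<in>UNIV. \<xi> j * p j (z + t *\<^sub>R v))" for t
  have \<phi>0: "\<phi> 0 = 0" by (simp add: \<phi>_def p0)
  have "(\<phi> has_real_derivative (\<Sum>j\<in>UNIV. \<xi> j * (\<Sum>i\<in>UNIV. \<xi> i * q i j (z + 0 *\<^sub>R v)))) (at 0)"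
    unfolding \<phi>_def
    by (rule DERIV_sum, rule DERIV_cmult, rule chain) (use p q \<open>z \<in> S\<close> in auto)
  also have "(\<Sum>j\<in>UNIV. \<xi> j * (\<Sum>i\<in>UNIV. \<xi> i * q i j (z + 0 *\<^sub>R v)))
      = (\<Sum>i\<in>UNIV. \<Sum>j\<in>UNIV. q i j z * \<xi> i * \<xi> j)" (is "_ = ?Q")
    by (subst sum.swap) (simp add: sum_distrib_left mult_ac)
  finally have D: "(\<phi> has_real_derivative ?Q) (at 0)" .
  show "?Q \<le> 0"
  proof (rule ccontr)
    assume "\<not> ?Q \<le> 0"
    then obtain d where d: "d > 0" "\<And>t. 0 < t \<Longrightarrow> t < d \<Longrightarrow> \<phi> t > 0"
      using has_real_derivative_pos_inc_right[OF D, of ] \<phi>0 by auto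
    have "norm v + 1 > 0" by (simp add: add_nonneg_pos)
    then have "d0 / (norm v + 1) > 0" using d0 by simp
    then obtain \<epsilon> where "\<epsilon> > 0" "\<epsilon> < d" "\<epsilon> < d0 / (norm v + 1)"
      using field_lbound_gt_zero[OF d(1)] by blast
    have inS: "z + t *\<^sub>R v \<in> S" if "0 \<le> t" "t \<le> \<epsilon>" for t
    proof -
      have "t * norm v \<le> \<epsilon> * (norm v + 1)" using that by (intro mult_mono) auto
      also have "\<dots> < d0" using \<open>\<epsilon> < d0 / (norm v + 1)\<close> \<open>norm v + 1 > 0\<close> by (simp add: field_simps)
      finally show ?thesis using d0 that by (auto simp: dist_norm subset_iff)
    qed
    have D1: "((\<lambda>t. h (z + t *\<^sub>R v)) has_real_derivative \<phi> t) (at t)" if "0 \<le> t" "t \<le> \<epsilon>" for t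
      unfolding \<phi>_def by (rule chain[OF h pc inS[OF that]])
    have "h (z + 0 *\<^sub>R v) < h (z + \<epsilon> *\<^sub>R v)"
    proof (rule DERIV_pos_imp_increasing_open[OF \<open>\<epsilon> > 0\<close>])
      show "\<exists>y. ((\<lambda>t. h (z + t *\<^sub>R v)) has_real_derivative y) (at t) \<and> 0 < y" if "0 < t" "t < \<epsilon>" for t
        using D1[of t] d(2)[of t] that \<open>\<epsilon> < d\<close> by auto
      show "continuous_on {0..\<epsilon>} (\<lambda>t. h (z + t *\<^sub>R v))"
      proof (intro continuous_at_imp_continuous_on ballI)
        fix t assume "t \<in> {0..\<epsilon>}"
        then show "isCont (\<lambda>t. h (z + t *\<^sub>R v)) t" by (intro DERIV_isCont[OF D1]) auto
      qed
    qed
    then show False using max[OF inS[of \<epsilon>]] \<open>\<epsilon> > 0\<close> by simp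
  qed
qed

text \<open>Instead of diagonalising one of the matrices, the proof eliminates one index \<open>k\<close> as in a Cholesky
  decomposition: \<open>A = A' + v v\<^sup>T / \<alpha>\<close> with \<open>v\<close> the column \<open>k\<close> of \<open>A\<close> and \<open>\<alpha> = A\<^sub>k\<^sub>k\<close>. The rank-one
  term contributes the value of the form \<open>Q\<close> at \<open>v\<close>, and the Schur complement \<open>A'\<close> lives on the
  remaining indices. It keeps the same lower bound \<open>\<theta>\<close>, which makes the induction work and ensures
  \<open>\<alpha> > 0\<close> at every stage.\<close>

lemma trace_product_nonpos:
  fixes A Q :: "'a \<Rightarrow> 'a \<Rightarrow> real"
  assumes "finite T" "\<theta> > 0" and "\<And>i j. A i j = A j i"
    and "\<And>\<xi>. (\<Sum>i\<in>T. \<Sum>j\<in>T. A i j * \<xi> i * \<xi> j) \<ge> \<theta> * (\<Sum>i\<in>T. (\<xi> i)\<^sup>2)"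
    and "\<And>\<xi>. (\<Sum>i\<in>T. \<Sum>j\<in>T. Q i j * \<xi> i * \<xi> j) \<le> 0"
  shows "(\<Sum>i\<in>T. \<Sum>j\<in>T. A i j * Q i j) \<le> 0"
  using assms
proof (induction T arbitrary: A rule: finite_induct)
  case empty
  then show ?case by simp
next
  case (insert k T)
  let ?T = "insert k T"
  note sym = insert.prems(2) and pos = insert.prems(3) and neg = insert.prems(4)
  have [simp]: "(\<Sum>i\<in>T. if i = k then f i else g i) = sum g T" for f g :: "'a \<Rightarrow> real"
    by (rule sum.cong) (use insert.hyps in auto)
  define \<alpha> where "\<alpha> = A k k"
  have "\<alpha> \<ge> \<theta>"
  proof -
    let ?e = "\<lambda>i. if i = k then 1 else 0 :: real"
    have r0: "(\<Sum>i\<in>T. r i * ?e i) = 0" for r :: "'a \<Rightarrow> real"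
      using insert.hyps by (intro sum.neutral) auto
    have "(\<Sum>i\<in>?T. \<Sum>j\<in>?T. A i j * ?e i * ?e j) = A k k"
      using insert.hyps by (simp add: r0 sum.neutral)
    moreover have "(\<Sum>i\<in>?T. (?e i)\<^sup>2) = 1"
      using insert.hyps r0[of ?e] by (simp add: power2_eq_square)
    ultimately show ?thesis using pos[of ?e] by (simp add: \<alpha>_def)
  qed
  then have "\<alpha> > 0" using \<open>\<theta> > 0\<close> by simp
  define A' where "A' i j = A i j - A i k * A j k / \<alpha>" for i j
  have A'0: "A' k j = 0" "A' i k = 0" for i j
    using \<open>\<alpha> > 0\<close> sym by (auto simp: A'_def \<alpha>_def[symmetric])
  have restrict: "(\<Sum>i\<in>?T. \<Sum>j\<in>?T. A' i j * X i j) = (\<Sum>i\<in>T. \<Sum>j\<in>T. A' i j * X i j)" for X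
    using insert.hyps by (simp add: A'0)
  have split: "(\<Sum>i\<in>?T. \<Sum>j\<in>?T. A i j * X i j)
      = (\<Sum>i\<in>T. \<Sum>j\<in>T. A' i j * X i j) + (\<Sum>i\<in>?T. \<Sum>j\<in>?T. X i j * A i k * A j k) / \<alpha>" for X
    unfolding restrict[symmetric] sum_divide_distrib sum.distrib[symmetric]
    by (intro sum.cong refl) (simp add: A'_def field_simps)
  have "(\<Sum>i\<in>T. \<Sum>j\<in>T. A' i j * Q i j) \<le> 0"
  proof (rule insert.IH)
    show "\<theta> > 0" by fact
    show "A' i j = A' j i" for i j using sym[of i j] by (simp add: A'_def)
    show "(\<Sum>i\<in>T. \<Sum>j\<in>T. Q i j * \<xi> i * \<xi> j) \<le> 0" for \<xi>
    proof -
      have "(\<Sum>i\<in>?T. \<Sum>j\<in>?T. Q i j * (\<xi>(k := 0)) i * (\<xi>(k := 0)) j)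
          = (\<Sum>i\<in>T. \<Sum>j\<in>T. Q i j * (\<xi>(k := 0)) i * (\<xi>(k := 0)) j)"
        using insert.hyps by simp
      also have "\<dots> = (\<Sum>i\<in>T. \<Sum>j\<in>T. Q i j * \<xi> i * \<xi> j)"
        using insert.hyps by (intro sum.cong refl) auto
      finally show ?thesis using neg[of "\<xi>(k := 0)"] by simp
    qed
    fix \<xi> :: "'a \<Rightarrow> real"
    \<comment> \<open>The extension of \<open>\<xi>\<close> that is \<open>A\<close>-orthogonal to \<open>e\<^sub>k\<close>: on it the rank-one term vanishes, so that
      \<open>A\<close> and \<open>A'\<close> give the same value.\<close>
    define \<eta> where "\<eta> = \<xi>(k := - (\<Sum>i\<in>T. A i k * \<xi> i) / \<alpha>)"
    have \<eta>T: "\<eta> i = \<xi> i" if "i \<in> T" for i using that insert.hyps by (auto simp: \<eta>_def)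
    have "(\<Sum>i\<in>?T. A i k * \<eta> i) = \<alpha> * \<eta> k + (\<Sum>i\<in>T. A i k * \<xi> i)"
      using insert.hyps \<eta>T by (simp add: \<alpha>_def)
    also have "\<dots> = 0" using \<open>\<alpha> > 0\<close> by (simp add: \<eta>_def)
    finally have z: "(\<Sum>i\<in>?T. A i k * \<eta> i) = 0" .
    have "(\<Sum>i\<in>?T. \<Sum>j\<in>?T. (\<eta> i * \<eta> j) * A i k * A j k) = (\<Sum>i\<in>?T. A i k * \<eta> i) * (\<Sum>j\<in>?T. A j k * \<eta> j)"
      unfolding sum_product by (intro sum.cong refl) simp
    then have "(\<Sum>i\<in>?T. \<Sum>j\<in>?T. A i j * (\<eta> i * \<eta> j)) = (\<Sum>i\<in>T. \<Sum>j\<in>T. A' i j * (\<eta> i * \<eta> j))"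
      unfolding split z by simp
    also have "\<dots> = (\<Sum>i\<in>T. \<Sum>j\<in>T. A' i j * \<xi> i * \<xi> j)"
      by (intro sum.cong refl) (simp add: \<eta>T)
    finally have "\<theta> * (\<Sum>i\<in>?T. (\<eta> i)\<^sup>2) \<le> (\<Sum>i\<in>T. \<Sum>j\<in>T. A' i j * \<xi> i * \<xi> j)"
      using pos[of \<eta>] by (simp only: mult.assoc)
    moreover have "(\<Sum>i\<in>T. (\<xi> i)\<^sup>2) \<le> (\<Sum>i\<in>?T. (\<eta> i)\<^sup>2)"
      using insert.hyps \<eta>T by simp
    then have "\<theta> * (\<Sum>i\<in>T. (\<xi> i)\<^sup>2) \<le> \<theta> * (\<Sum>i\<in>?T. (\<eta> i)\<^sup>2)"
      using \<open>\<theta> > 0\<close> by (intro mult_left_mono) auto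
    ultimately show "\<theta> * (\<Sum>i\<in>T. (\<xi> i)\<^sup>2) \<le> (\<Sum>i\<in>T. \<Sum>j\<in>T. A' i j * \<xi> i * \<xi> j)" by linarith
  qed
  moreover have "(\<Sum>i\<in>?T. \<Sum>j\<in>?T. Q i j * A i k * A j k) / \<alpha> \<le> 0"
    using neg \<open>\<alpha> > 0\<close> by (simp add: divide_nonpos_pos)
  ultimately show ?case unfolding split by linarith
qed

section \<open>Elliptic operators at a maximum\<close>

text \<open>On the actual partials this is \<^const>\<open>elliptic_op\<close>; taking them as arguments makes linearity an
  algebraic identity.\<close>

definition jet_op ::
  "('n \<Rightarrow> 'n \<Rightarrow> real^'n \<Rightarrow> real) \<Rightarrow> ('n \<Rightarrow> real^'n \<Rightarrow> real) \<Rightarrow> (real^'n \<Rightarrow> real) \<Rightarrow>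
    (real^'n \<Rightarrow> real) \<Rightarrow> ('n \<Rightarrow> real^'n \<Rightarrow> real) \<Rightarrow> ('n \<Rightarrow> 'n \<Rightarrow> real^'n \<Rightarrow> real) \<Rightarrow>
    real^'n \<Rightarrow> real" where
  "jet_op a b c h p q x =
     (\<Sum>i\<in>UNIV. \<Sum>j\<in>UNIV. a i j x * q i j x) + (\<Sum>i\<in>UNIV. b i x * p i x) + c x * h x"

lemma jet_op_diff:
  "jet_op a b c (\<lambda>x. h x - h' x) (\<lambda>i x. p i x - p' i x) (\<lambda>i j x. q i j x - q' i j x) x
     = jet_op a b c h p q x - jet_op a b c h' p' q' x"
  unfolding jet_op_def by (simp add: right_diff_distrib sum_subtractf)

definition elliptic_at :: "('n \<Rightarrow> 'n \<Rightarrow> real^'n \<Rightarrow> real) \<Rightarrow> real \<Rightarrow> real^'n \<Rightarrow> bool" where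
  "elliptic_at a \<theta> x \<longleftrightarrow> (\<forall>\<xi>::real^'n.
     (\<Sum>i\<in>UNIV. \<Sum>j\<in>UNIV. a i j x * \<xi>$i * \<xi>$j) \<ge> \<theta> * (\<Sum>i\<in>UNIV. (\<xi>$i)\<^sup>2))"

lemma elliptic_at_diagonal:
  fixes a :: "'n \<Rightarrow> 'n \<Rightarrow> real^'n \<Rightarrow> real"
  assumes "elliptic_at a \<theta> x"
  shows "\<theta> \<le> a k k x"
proof -
  have "(\<Sum>i\<in>UNIV. \<Sum>j\<in>UNIV. a i j x * axis k 1 $ i * axis k 1 $ j) = a k k x"
    by (simp add: axis_def if_distrib[of "\<lambda>x. _ * x"] cong: if_cong)
  moreover have "(\<Sum>i\<in>UNIV. (axis k (1::real) $ i)\<^sup>2) = 1"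
    by (simp add: axis_def power2_eq_square if_distrib[of "\<lambda>x. _ * x"] cong: if_cong)
  ultimately show ?thesis
    using assms[unfolded elliptic_at_def, rule_format, of "axis k 1"] by simp
qed

text \<open>Justifies the use of \<^const>\<open>Greatest\<close> for the local ellipticity constant: the admissible constants are bounded by the
  diagonal entries of the matrix, and each inequality that defines them passes to the supremum, so
  the supremum is attained.\<close>

lemma ellipticity_const_greatest:
  fixes a :: "'n \<Rightarrow> 'n \<Rightarrow> real^'n \<Rightarrow> real"
  assumes "elliptic_at a \<theta>0 x"
  shows "elliptic_at a (ellipticity_const a x) x" "\<theta>0 \<le> ellipticity_const a x"
proof -
  let ?B = "\<lambda>\<xi>::real^'n. \<Sum>i\<in>UNIV. \<Sum>j\<in>UNIV. a i j x * \<xi>$i * \<xi>$j"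
  let ?N = "\<lambda>\<xi>::real^'n. \<Sum>i\<in>UNIV. (\<xi>$i)\<^sup>2"
  let ?E = "{\<theta>. elliptic_at a \<theta> x}"
  have bdd: "bdd_above ?E" using elliptic_at_diagonal by (intro bdd_aboveI[of _ "a undefined undefined x"]) auto
  have "\<forall>\<xi>. Sup ?E * ?N \<xi> \<le> ?B \<xi>"
  proof
    fix \<xi> :: "real^'n"
    have le: "\<theta> * ?N \<xi> \<le> ?B \<xi>" if "\<theta> \<in> ?E" for \<theta>
      using that by (simp add: elliptic_at_def)
    consider "?N \<xi> = 0" | "?N \<xi> > 0" using sum_nonneg[of UNIV "\<lambda>i. (\<xi>$i)\<^sup>2"] by fastforce
    then show "Sup ?E * ?N \<xi> \<le> ?B \<xi>"
    proof cases
      case 1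
      then show ?thesis using le[of \<theta>0] assms by simp
    next
      case 2
      have "Sup ?E \<le> ?B \<xi> / ?N \<xi>"
        by (rule cSup_least) (use assms le 2 in \<open>auto simp: pos_le_divide_eq\<close>)
      then show ?thesis using 2 by (simp add: pos_le_divide_eq)
    qed
  qed
  then have Sup: "elliptic_at a (Sup ?E) x" by (subst elliptic_at_def)
  have "ellipticity_const a x = Sup ?E"
    unfolding ellipticity_const_def elliptic_at_def[symmetric]
    by (rule Greatest_equality) (use Sup bdd in \<open>auto intro: cSup_upper\<close>)
  then show "elliptic_at a (ellipticity_const a x) x" "\<theta>0 \<le> ellipticity_const a x"
    using Sup bdd assms by (auto intro: cSup_upper)
qed

text \<open>At a nonnegative interior maximum the gradient vanishes, the zeroth-order term has the right sign,
  and the second-order part is the trace of a product as in the lemma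
  \<open>trace_product_nonpos\<close>. The coefficient matrix may be asymmetric; because the Hessian is
  symmetric, only the symmetric part of the coefficients matters.\<close>

lemma operator_nonpos_at_maximum:
  fixes a :: "'n \<Rightarrow> 'n \<Rightarrow> real^'n \<Rightarrow> real"
  assumes "open S" "z \<in> S" and jet: "c2_jet S h p q"
    and max: "\<And>y. y \<in> S \<Longrightarrow> h y \<le> h z"
    and "h z \<ge> 0" "c z \<le> 0" "\<theta> > 0" "elliptic_at a \<theta> z"
  shows "jet_op a b c h p q z \<le> 0"
proof -
  have p0: "p i z = 0" and Q: "(\<Sum>i\<in>UNIV. \<Sum>j\<in>UNIV. q i j z * \<xi> i * \<xi> j) \<le> 0" for i \<xi>
    using interior_maximum_conditions[OF assms(1,2) jet max] by blast+
  have q_sym: "q i j z = q j i z" for i j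
    by (rule mixed_axis_derivs_commute[OF assms(1,2) jet])
  let ?A = "\<lambda>i j. (a i j z + a j i z) / 2"
  have symm: "(\<Sum>i\<in>UNIV. \<Sum>j\<in>UNIV. ?A i j * X i j) = (\<Sum>i\<in>UNIV. \<Sum>j\<in>UNIV. a i j z * X i j)"
    if X: "\<And>i j. X i j = X j i" for X
  proof -
    have "(\<Sum>i\<in>UNIV. \<Sum>j\<in>UNIV. a j i z * X i j) = (\<Sum>i\<in>UNIV. \<Sum>j\<in>UNIV. a i j z * X i j)"
      by (subst sum.swap) (simp add: X)
    then show ?thesis
      by (simp add: add_divide_distrib distrib_right sum.distrib flip: sum_divide_distrib)
  qed
  have "(\<Sum>i\<in>UNIV. \<Sum>j\<in>UNIV. ?A i j * q i j z) \<le> 0"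
  proof (rule trace_product_nonpos[OF finite \<open>\<theta> > 0\<close>])
    fix \<xi> :: "'n \<Rightarrow> real"
    have "\<theta> * (\<Sum>i\<in>UNIV. (\<xi> i)\<^sup>2) \<le> (\<Sum>i\<in>UNIV. \<Sum>j\<in>UNIV. a i j z * \<xi> i * \<xi> j)"
      using \<open>elliptic_at a \<theta> z\<close>[unfolded elliptic_at_def, rule_format, of "\<chi> i. \<xi> i"] by simp
    then show "\<theta> * (\<Sum>i\<in>UNIV. (\<xi> i)\<^sup>2) \<le> (\<Sum>i\<in>UNIV. \<Sum>j\<in>UNIV. ?A i j * \<xi> i * \<xi> j)"
      using symm[of "\<lambda>i j. \<xi> i * \<xi> j"] by (simp add: mult_ac)
  qed (use Q in \<open>auto simp: add.commute\<close>)
  then have "(\<Sum>i\<in>UNIV. \<Sum>j\<in>UNIV. a i j z * q i j z) \<le> 0"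
    using symm[of "\<lambda>i j. q i j z", OF q_sym] by (simp only:)
  moreover have "c z * h z \<le> 0" using assms by (simp add: mult_nonpos_nonneg)
  ultimately show ?thesis by (simp add: jet_op_def p0)
qed

section \<open>Comparison with a barrier\<close>

text \<open>The comparison function: it depends on one coordinate only, and its strong concavity lets the
  second-order term dominate the drift.\<close>

lemma c2_jet_barrier:
  "c2_jet S (\<lambda>x. C - F * exp (\<alpha> * (x$k - s)))
     (\<lambda>i x. if i = k then - (F * \<alpha> * exp (\<alpha> * (x$k - s))) else 0)
     (\<lambda>i j x. if i = k \<and> j = k then - (F * \<alpha>\<^sup>2 * exp (\<alpha> * (x$k - s))) else 0)"
  unfolding c2_jet_def axis_derivs_on_def
proof (intro conjI allI ballI, goal_cases)
  case (1 x i)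
  show ?case
    by (cases "i = k") (auto simp: axis_def intro!: derivative_eq_intros)
next
  case (2 j x i)
  show ?case
    by (cases "j = k"; cases "i = k")
      (auto simp: axis_def power2_eq_square intro!: derivative_eq_intros)
next
  case (3 i)
  show ?case by (cases "i = k") (auto intro!: continuous_intros)
next
  case (4 i j)
  show ?case by (cases "i = k \<and> j = k") (auto intro!: continuous_intros)
qed

text \<open>The heart of the estimate. Let the closure of \<open>\<Omega>\<close> lie in the slab \<open>s \<le> x\<^sub>k \<le> s + D\<close>, where \<open>D\<close> is
  the diameter, let \<open>\<alpha> = \<beta> + 1\<close>, and let
  \<open>v x = H + F (e\<^bsup>\<alpha>D\<^esup> - e\<^bsup>\<alpha>(x\<^sub>k - s)\<^esup>)\<close>. Then \<open>H \<le> v \<le> H + F (e\<^bsup>\<alpha>D\<^esup> - 1)\<close>. Where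
  the drift is at most \<open>\<beta> \<theta>\<close>, one has \<open>a\<^sub>k\<^sub>k \<alpha> + b\<^sub>k \<ge> \<theta> (\<alpha> - \<beta>) = \<theta>\<close>, so that
  the operator applied to \<open>v\<close> is strictly below \<open>- F \<theta>\<close>. Thus \<open>w - v\<close>
  would violate \<open>operator_nonpos_at_maximum\<close> at a positive interior maximum.

  The bound on the drift is required only where \<open>w > H\<close>, because a positive maximum of \<open>w - v\<close>
  can only occur there. This makes the lemma applicable to drifts that are merely locally bounded.\<close>

lemma barrier_comparison:
  fixes \<Omega> :: "(real^'n) set"
  assumes "open \<Omega>" "\<Omega> \<noteq> {}" "bounded \<Omega>"
    and jet: "c2_jet \<Omega> w p q" and wc: "continuous_on (closure \<Omega>) w"
    and "H \<ge> 0" "F > 0" "\<beta> \<ge> 0"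
    and bd: "\<And>x. x \<in> frontier \<Omega> \<Longrightarrow> w x \<le> H"
    and c: "\<And>x. x \<in> \<Omega> \<Longrightarrow> c x \<le> 0"
    and \<theta>: "\<And>x. x \<in> \<Omega> \<Longrightarrow> \<theta> x > 0" "\<And>x. x \<in> \<Omega> \<Longrightarrow> elliptic_at a (\<theta> x) x"
    and b: "\<And>x. x \<in> \<Omega> \<Longrightarrow> w x > H \<Longrightarrow> \<bar>b k x\<bar> \<le> \<beta> * \<theta> x"
    and L: "\<And>x. x \<in> \<Omega> \<Longrightarrow> jet_op a b c w p q x \<ge> - (F * \<theta> x)"
    and x0: "x0 \<in> \<Omega>"
  shows "w x0 \<le> H + F * (exp ((\<beta> + 1) * diameter \<Omega>) - 1)"
proof (rule ccontr)
  assume not: "\<not> ?thesis"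
  let ?D = "diameter \<Omega>" and ?K = "closure \<Omega>"
  have K: "compact ?K" "?K \<noteq> {}" "bounded ?K"
    using assms(2,3) by (auto simp: compact_closure)
  have "continuous_on ?K (\<lambda>x. x$k)" by (intro continuous_intros)
  then obtain y where y: "y \<in> ?K" "\<And>x. x \<in> ?K \<Longrightarrow> y$k \<le> x$k"
    using continuous_attains_inf[OF K(1,2), of "\<lambda>x. x$k"] by blast
  define s where "s = y$k"
  have width: "s \<le> x$k" "x$k - s \<le> ?D" if "x \<in> ?K" for x
  proof -
    have "\<bar>(x - y)$k\<bar> \<le> norm (x - y)" by (rule component_le_norm_cart)
    also have "\<dots> \<le> diameter ?K"
      using diameter_bounded_bound[OF K(3) that y(1)] by (simp add: dist_norm)
    finally show "s \<le> x$k" "x$k - s \<le> ?D"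
      using y(2)[OF that] \<open>bounded \<Omega>\<close> by (simp_all add: s_def diameter_closure)
  qed
  \<comment> \<open>An open set does not reach the face of the slab; this is the source of the strict inequality.\<close>
  have strict: "s < x$k" if x: "x \<in> \<Omega>" for x
  proof -
    obtain r where r: "r > 0" "ball x r \<subseteq> \<Omega>" using openE[OF assms(1) x] by blast
    have "x - (r/2) *\<^sub>R axis k 1 \<in> \<Omega>"
      using r by (auto simp: dist_norm norm_axis_1 subset_iff)
    then have "s \<le> (x - (r/2) *\<^sub>R axis k 1)$k" using width(1) closure_subset by blast
    then show ?thesis using r by (simp add: axis_def)
  qed
  define \<alpha> where "\<alpha> = \<beta> + 1"
  have \<alpha>: "\<alpha> \<ge> 1" using \<open>\<beta> \<ge> 0\<close> by (simp add: \<alpha>_def)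
  define C where "C = H + F * exp (\<alpha> * ?D)"
  define e where "e x = exp (\<alpha> * (x$k - s))" for x :: "real^'n"
  let ?v = "\<lambda>x::real^'n. C - F * exp (\<alpha> * (x$k - s))"
  let ?pv = "\<lambda>i (x::real^'n). if i = k then - (F * \<alpha> * exp (\<alpha> * (x$k - s))) else 0"
  let ?qv = "\<lambda>i j (x::real^'n). if i = k \<and> j = k then - (F * \<alpha>\<^sup>2 * exp (\<alpha> * (x$k - s))) else 0"
  let ?h = "\<lambda>x. w x - ?v x"
  have v_ge: "?v x \<ge> H" if "x \<in> ?K" for x
  proof -
    have "exp (\<alpha> * (x$k - s)) \<le> exp (\<alpha> * ?D)"
      using width(2)[OF that] \<alpha> by simp
    then show ?thesis using \<open>F > 0\<close> by (simp add: C_def)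
  qed
  have e_gt: "e x > 1" if "x \<in> \<Omega>" for x
    using strict[OF that] \<alpha> by (simp add: e_def)
  have "continuous_on ?K ?h" by (intro continuous_intros wc)
  then obtain z where z: "z \<in> ?K" "\<And>x. x \<in> ?K \<Longrightarrow> ?h x \<le> ?h z"
    using continuous_attains_sup[OF K(1,2)] by blast
  have "?h x0 > 0"
  proof -
    have "F * 1 \<le> F * e x0" using e_gt[OF x0] \<open>F > 0\<close> by (intro mult_left_mono) auto
    then show ?thesis using not by (simp add: C_def \<alpha>_def e_def algebra_simps)
  qed
  then have hz: "?h z > 0" using z(2)[of x0] x0 closure_subset by fastforce
  then have wz: "w z > H" using v_ge[OF z(1)] by linarith
  have z\<Omega>: "z \<in> \<Omega>"
    using z(1) bd[of z] wz \<open>open \<Omega>\<close> by (auto simp: frontier_def interior_open)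
  let ?op = "jet_op a b c"
  have "?op ?h (\<lambda>i x. p i x - ?pv i x) (\<lambda>i j x. q i j x - ?qv i j x) z \<le> 0"
    by (rule operator_nonpos_at_maximum[OF \<open>open \<Omega>\<close> z\<Omega> c2_jet_diff[OF jet c2_jet_barrier]])
      (use z(2) closure_subset hz c \<theta> z\<Omega> in auto)
  then have "?op w p q z \<le> ?op ?v ?pv ?qv z"
    unfolding jet_op_diff by simp
  also have "?op ?v ?pv ?qv z = - (F * \<alpha> * e z * (a k k z * \<alpha> + b k z)) + c z * ?v z"
  proof -
    have "(\<Sum>i\<in>UNIV. \<Sum>j\<in>UNIV. a i j z * ?qv i j z) = a k k z * ?qv k k z"
    proof -
      have "a i j z * ?qv i j z = (if i = k then if j = k then a k k z * ?qv k k z else 0 else 0)" for i j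
        by auto
      then have "(\<Sum>j\<in>UNIV. a i j z * ?qv i j z) = (if i = k then a k k z * ?qv k k z else 0)" for i
        by simp
      then show ?thesis by simp
    qed
    moreover have "(\<Sum>i\<in>UNIV. b i z * ?pv i z) = b k z * ?pv k z"
      by (simp add: if_distrib[of "\<lambda>x. _ * x"] cong: if_cong)
    ultimately show ?thesis
      unfolding jet_op_def by (simp add: e_def power2_eq_square algebra_simps)
  qed
  also have "\<dots> \<le> - (F * \<alpha> * e z * (a k k z * \<alpha> + b k z))"
    using c[OF z\<Omega>] v_ge[OF z(1)] \<open>H \<ge> 0\<close> by (simp add: mult_nonpos_nonneg)
  also have "\<dots> < - (F * \<theta> z)"
  proof -
    have "\<theta> z * \<alpha> \<le> a k k z * \<alpha>"
      using elliptic_at_diagonal[OF \<theta>(2)[OF z\<Omega>]] \<alpha> by (intro mult_right_mono) auto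
    then have 1: "\<theta> z \<le> a k k z * \<alpha> + b k z"
      using b[OF z\<Omega> wz] by (simp add: \<alpha>_def algebra_simps)
    have "1 < \<alpha> * e z" using \<alpha> e_gt[OF z\<Omega>] by (metis less_1_mult less_eq_real_def mult_1)
    then have "F * \<theta> z * 1 < F * \<theta> z * (\<alpha> * e z)"
      using \<open>F > 0\<close> \<theta>(1)[OF z\<Omega>] by (intro mult_strict_left_mono) auto
    also have "\<dots> \<le> F * (a k k z * \<alpha> + b k z) * (\<alpha> * e z)"
      using 1 \<open>F > 0\<close> \<open>1 < \<alpha> * e z\<close> by (intro mult_right_mono mult_left_mono) auto
    finally show ?thesis by (simp add: mult_ac)
  qed
  finally show False using L[OF z\<Omega>] by simp
qed

text \<open>The drift is continuous but possibly unbounded near the boundary. For \<open>\<epsilon> > 0\<close> the set where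
  \<open>w \<ge> H + \<epsilon>\<close> is a compact subset of \<open>\<Omega>\<close>, so the drift is bounded there, and the barrier comparison
  applies at level \<open>H + \<epsilon>\<close> with an \<open>F\<close> so small that its contribution is below \<open>\<epsilon>\<close>.\<close>

lemma weak_maximum_principle:
  fixes \<Omega> :: "(real^'n) set"
  assumes "open \<Omega>" "\<Omega> \<noteq> {}" "bounded \<Omega>"
    and jet: "c2_jet \<Omega> w p q" and wc: "continuous_on (closure \<Omega>) w"
    and "H \<ge> 0" "\<theta>0 > 0"
    and bd: "\<And>x. x \<in> frontier \<Omega> \<Longrightarrow> w x \<le> H"
    and c: "\<And>x. x \<in> \<Omega> \<Longrightarrow> c x \<le> 0"
    and ell: "\<And>x. x \<in> \<Omega> \<Longrightarrow> elliptic_at a \<theta>0 x"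
    and b: "\<And>i. continuous_on \<Omega> (b i)"
    and L: "\<And>x. x \<in> \<Omega> \<Longrightarrow> jet_op a b c w p q x \<ge> 0"
    and x0: "x0 \<in> \<Omega>"
  shows "w x0 \<le> H"
proof (rule ccontr)
  assume "\<not> w x0 \<le> H"
  \<comment> \<open>Half of the supposed excess is spent on the level, half on the barrier.\<close>
  define \<epsilon> where "\<epsilon> = (w x0 - H) / 2"
  have "\<epsilon> > 0" using \<open>\<not> w x0 \<le> H\<close> by (simp add: \<epsilon>_def)
  let ?K = "closure \<Omega> \<inter> w -` {H + \<epsilon>..}"
  have "closed ?K" by (rule continuous_closed_preimage[OF wc]) auto
  then have "compact ?K"
    using \<open>bounded \<Omega>\<close> by (meson bounded_Int bounded_closure compact_eq_bounded_closed)
  have "?K \<subseteq> \<Omega>"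
    using bd \<open>\<epsilon> > 0\<close> \<open>open \<Omega>\<close> by (force simp: frontier_def interior_open)
  fix k :: 'n
  have "compact (b k ` ?K)"
    using \<open>compact ?K\<close> continuous_on_subset[OF b \<open>?K \<subseteq> \<Omega>\<close>] compact_continuous_image by blast
  then obtain B where "B > 0" and B: "\<And>x. x \<in> ?K \<Longrightarrow> \<bar>b k x\<bar> \<le> B"
    using compact_imp_bounded bounded_pos by (metis imageI real_norm_def)
  define \<beta> where "\<beta> = B / \<theta>0"
  define E where "E = exp ((\<beta> + 1) * diameter \<Omega>)"
  have "E > 0" by (simp add: E_def)
  have "w x0 \<le> (H + \<epsilon>) + (\<epsilon> / E) * (exp ((\<beta> + 1) * diameter \<Omega>) - 1)"
  proof (rule barrier_comparison[OF assms(1-3) jet wc, where \<theta> = "\<lambda>_. \<theta>0" and k = k])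
    show "H + \<epsilon> \<ge> 0" "\<epsilon> / E > 0" "\<beta> \<ge> 0"
      using \<open>H \<ge> 0\<close> \<open>\<epsilon> > 0\<close> \<open>E > 0\<close> \<open>B > 0\<close> \<open>\<theta>0 > 0\<close> by (auto simp: \<beta>_def)
    show "w x \<le> H + \<epsilon>" if "x \<in> frontier \<Omega>" for x
      using bd[OF that] \<open>\<epsilon> > 0\<close> by simp
    show "\<bar>b k x\<bar> \<le> \<beta> * \<theta>0" if "x \<in> \<Omega>" "w x > H + \<epsilon>" for x
      using B[of x] that closure_subset \<open>\<theta>0 > 0\<close> by (force simp: \<beta>_def)
    show "- (\<epsilon> / E * \<theta>0) \<le> jet_op a b c w p q x" if "x \<in> \<Omega>" for x
    proof -
      have "\<epsilon> / E * \<theta>0 > 0" using \<open>\<epsilon> > 0\<close> \<open>E > 0\<close> \<open>\<theta>0 > 0\<close> by simp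
      then show ?thesis using L[OF that] by linarith
    qed
  qed (use c ell \<open>\<theta>0 > 0\<close> x0 in auto)
  also have "\<dots> = H + 2 * \<epsilon> - \<epsilon> / E"
    using \<open>E > 0\<close> unfolding E_def[symmetric] by (simp add: field_simps)
  also have "\<dots> < H + 2 * \<epsilon>" using \<open>\<epsilon> > 0\<close> \<open>E > 0\<close> by simp
  also have "\<dots> = w x0" by (simp add: \<epsilon>_def field_simps)
  finally show False by simp
qed

section \<open>The a priori estimate\<close>

lemma ennexp_minus_1_eq:
  "ennexp t - 1 = (if t = \<infinity> then \<infinity> else ennreal (exp (enn2real t) - 1))"
  unfolding ennexp_def by (simp add: ennreal_minus flip: ennreal_1)

text \<open>The three regimes of the bound in \<open>[0,\<infinity>]\<close>. If \<open>f\<close> vanishes, the product is \<open>0\<close> even when the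
  drift bound is infinite, so a genuine statement remains, namely the weak maximum principle. If
  \<open>f\<close> does not vanish and the drift bound or the supremum for \<open>f\<close> is infinite, then so is the
  right-hand side, because the exponential factor is positive. In the remaining case the barrier
  comparison applies with real parameters.\<close>

lemma one_sided_estimate:
  fixes \<Omega> :: "(real^'n) set"
  assumes "open \<Omega>" "\<Omega> \<noteq> {}" "bounded \<Omega>"
    and jet: "c2_jet \<Omega> w p q" and wc: "continuous_on (closure \<Omega>) w"
    and ell: "uniformly_elliptic_on \<Omega> a"
    and b: "\<And>i. continuous_on \<Omega> (b i)"
    and c: "\<And>x. x \<in> \<Omega> \<Longrightarrow> c x \<le> 0"
    and bd: "\<And>x. x \<in> frontier \<Omega> \<Longrightarrow> w x \<le> \<bar>g x\<bar>"
    and L: "\<And>x. x \<in> \<Omega> \<Longrightarrow> jet_op a b c w p q x \<ge> - \<bar>f x\<bar>"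
    and x0: "x0 \<in> \<Omega>"
  shows "ennreal (w x0) \<le> (SUP x\<in>frontier \<Omega>. ennreal \<bar>g x\<bar>)
      + (ennexp ((drift_bound \<Omega> a b + 1) * ennreal (diameter \<Omega>)) - 1)
        * (SUP x\<in>\<Omega>. ennreal \<bar>f x / ellipticity_const a x\<bar>)"
    (is "_ \<le> ?G + (ennexp ?t - 1) * ?F")
proof (cases "?G = \<infinity>")
  case True
  show ?thesis by (simp only: True) simp
next
  case False
  define D where "D = diameter \<Omega>"
  let ?\<theta> = "ellipticity_const a"
  obtain \<theta>0 where "\<theta>0 > 0" and \<theta>0: "\<And>x. x \<in> \<Omega> \<Longrightarrow> elliptic_at a \<theta>0 x"
    using ell unfolding uniformly_elliptic_on_def elliptic_at_def by blast
  have \<theta>: "elliptic_at a (?\<theta> x) x" "?\<theta> x > 0" if "x \<in> \<Omega>" for x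
    using ellipticity_const_greatest[OF \<theta>0[OF that]] \<open>\<theta>0 > 0\<close> by auto
  obtain H where H: "H \<ge> 0" "?G = ennreal H" using False by (cases ?G) auto
  have bdH: "w x \<le> H" if "x \<in> frontier \<Omega>" for x
  proof -
    have "ennreal \<bar>g x\<bar> \<le> ?G" using that by (intro SUP_upper)
    then show ?thesis using bd[OF that] H by (simp add: ennreal_le_iff)
  qed
  show ?thesis
  proof (cases "?F = 0")
    case True
    have "f x = 0" if "x \<in> \<Omega>" for x
    proof -
      have "ennreal \<bar>f x / ?\<theta> x\<bar> \<le> ?F" using that by (intro SUP_upper)
      then show ?thesis using True \<theta>(2)[OF that] by simp
    qed
    then have L0: "jet_op a b c w p q x \<ge> 0" if "x \<in> \<Omega>" for x
      using L[OF that] that by simp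
    have "w x0 \<le> H"
      by (rule weak_maximum_principle[where a = a and b = b and c = c,
            OF assms(1-3) jet wc H(1) \<open>\<theta>0 > 0\<close> bdH c \<theta>0 b L0 x0])
    then show ?thesis using True H by (simp add: ennreal_leI)
  next
    case F: False
    have "D > 0"
    proof -
      obtain r where r: "r > 0" "ball x0 r \<subseteq> \<Omega>" using openE[OF assms(1) x0] by blast
      have "x0 + (r/2) *\<^sub>R axis undefined 1 \<in> \<Omega>"
        using r by (auto simp: dist_norm norm_axis_1 subset_iff)
      from diameter_bounded_bound[OF \<open>bounded \<Omega>\<close> x0 this] show ?thesis
        using r by (simp add: D_def dist_norm norm_axis_1)
    qed
    show ?thesis
    proof (cases "drift_bound \<Omega> a b = \<infinity> \<or> ?F = \<infinity>")
      case True
      have "0 < drift_bound \<Omega> a b + 1" by (rule add_nonneg_pos) auto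
      then have "?t > 0" using \<open>D > 0\<close> by (simp add: ennreal_zero_less_mult_iff D_def)
      then have "enn2real ?t > 0" if "?t \<noteq> \<infinity>"
        using that by (simp add: enn2real_positive_iff less_top)
      then have "ennexp ?t - 1 > 0" unfolding ennexp_minus_1_eq by simp
      moreover have "ennexp ?t - 1 = \<infinity>" if "drift_bound \<Omega> a b = \<infinity>"
        unfolding ennexp_minus_1_eq using that \<open>D > 0\<close> by (simp add: D_def ennreal_top_mult)
      ultimately have "(ennexp ?t - 1) * ?F = \<infinity>"
        using True F by (auto simp: ennreal_mult_eq_top_iff)
      then show ?thesis by simp
    next
      case False
      obtain \<beta> where \<beta>: "\<beta> \<ge> 0" "drift_bound \<Omega> a b = ennreal \<beta>"
        using False by (cases "drift_bound \<Omega> a b") auto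
      obtain F where F': "F \<ge> 0" "?F = ennreal F"
        using False by (cases ?F) auto
      have "F > 0" using F F' by (cases "F = 0") auto
      have f_le: "\<bar>f x\<bar> \<le> F * ?\<theta> x" if "x \<in> \<Omega>" for x
      proof -
        have "ennreal \<bar>f x / ?\<theta> x\<bar> \<le> ?F" using that by (intro SUP_upper)
        then have "\<bar>f x / ?\<theta> x\<bar> \<le> F" using F' by (simp add: ennreal_le_iff)
        then show ?thesis using \<theta>(2)[OF that] by (simp add: pos_divide_le_eq)
      qed
      fix k :: 'n
      have b_le: "\<bar>b k x\<bar> \<le> \<beta> * ?\<theta> x" if "x \<in> \<Omega>" for x
      proof -
        have "ennreal \<bar>b k x / ?\<theta> x\<bar> \<le> (SUP x\<in>\<Omega>. ennreal \<bar>b k x / ?\<theta> x\<bar>)"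
          using that by (intro SUP_upper)
        also have "\<dots> \<le> drift_bound \<Omega> a b"
          unfolding drift_bound_def by (rule Max_ge) auto
        finally have "\<bar>b k x / ?\<theta> x\<bar> \<le> \<beta>" using \<beta> by (simp add: ennreal_le_iff)
        then show ?thesis using \<theta>(2)[OF that] by (simp add: pos_divide_le_eq)
      qed
      have L_ge: "jet_op a b c w p q x \<ge> - (F * ?\<theta> x)" if "x \<in> \<Omega>" for x
        using L[OF that] f_le[OF that] by linarith
      have "w x0 \<le> H + F * (exp ((\<beta> + 1) * diameter \<Omega>) - 1)"
        by (rule barrier_comparison[where a = a and b = b and c = c and \<theta> = ?\<theta> and k = k,
              OF assms(1-3) jet wc H(1) \<open>F > 0\<close> \<beta>(1) bdH c \<theta>(2,1) b_le L_ge x0])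
      moreover have "?t = ennreal ((\<beta> + 1) * D)"
        using \<beta> \<open>D > 0\<close> by (simp add: D_def ennreal_mult flip: ennreal_1 ennreal_plus)
      then have "ennexp ?t - 1 = ennreal (exp ((\<beta> + 1) * D) - 1)"
        unfolding ennexp_minus_1_eq using \<beta> \<open>D > 0\<close> by simp
      ultimately show ?thesis
        using H F' \<beta>(1) \<open>D > 0\<close>
        by (simp add: D_def mult.commute ennreal_leI flip: ennreal_mult ennreal_plus)
    qed
  qed
qed

theorem theorem2p4:
  fixes \<Omega> :: "(real^'d) set"
    and a :: "'d \<Rightarrow> 'd \<Rightarrow> real^'d \<Rightarrow> real"
    and b :: "'d \<Rightarrow> real^'d \<Rightarrow> real"
    and c f g \<Delta>f \<Delta>g u u' :: "real^'d \<Rightarrow> real"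
  assumes "open \<Omega>" "connected \<Omega>" "\<Omega> \<noteq> {}" "bounded \<Omega>"
    and "\<And>i j. continuous_on \<Omega> (a i j)"
    and "\<And>i. continuous_on \<Omega> (b i)"
    and "continuous_on \<Omega> c"
    and "uniformly_elliptic_on \<Omega> a"
    and "\<And>x. x \<in> \<Omega> \<Longrightarrow> c x \<le> 0"
    and "solves_dirichlet \<Omega> (elliptic_op a b c) f g u"
    and "solves_dirichlet \<Omega> (elliptic_op a b c)
           (\<lambda>x. f x + \<Delta>f x) (\<lambda>x. g x + \<Delta>g x) u'"
  shows "(SUP x\<in>\<Omega>. ennreal \<bar>u x - u' x\<bar>)
    \<le> (SUP x\<in>frontier \<Omega>. ennreal \<bar>\<Delta>g x\<bar>)
      + (ennexp ((drift_bound \<Omega> a b + 1) * ennreal (diameter \<Omega>)) - 1)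
        * (SUP x\<in>\<Omega>. ennreal \<bar>\<Delta>f x / ellipticity_const a x\<bar>)"
    (is "_ \<le> ?R")
proof (rule SUP_least)
  fix x assume x: "x \<in> \<Omega>"
  note u = assms(10)[unfolded solves_dirichlet_def] and u' = assms(11)[unfolded solves_dirichlet_def]
  have op: "elliptic_op a b c v y
      = jet_op a b c v (\<lambda>i. partial i v) (\<lambda>i j. partial i (partial j v)) y" for v y
    by (simp add: elliptic_op_def jet_op_def)
  have jet: "c2_jet \<Omega> v (\<lambda>i. partial i v) (\<lambda>i j. partial i (partial j v))" if "v \<in> {u, u'}" for v
    using that u u' by (auto intro: c2_jet_of_C2_on)
  have one_sided: "ennreal (v x - v' x) \<le> ?R" if vv: "{v, v'} = {u, u'}" for v v'
  proof (rule one_sided_estimate[OF assms(1,3,4) c2_jet_diff[OF jet jet]])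
    have cases: "v = u \<and> v' = u' \<or> v = u' \<and> v' = u" using vv by (auto simp: doubleton_eq_iff)
    show "v \<in> {u, u'}" "v' \<in> {u, u'}" using vv by auto
    show "continuous_on (closure \<Omega>) (\<lambda>x. v x - v' x)"
      using cases u u' by (auto intro!: continuous_on_diff)
    show "v y - v' y \<le> \<bar>\<Delta>g y\<bar>" if "y \<in> frontier \<Omega>" for y
      using cases u u' that by auto
    show "- \<bar>\<Delta>f y\<bar> \<le> jet_op a b c (\<lambda>x. v x - v' x) (\<lambda>i x. partial i v x - partial i v' x)
        (\<lambda>i j x. partial i (partial j v) x - partial i (partial j v') x) y" if "y \<in> \<Omega>" for y
      unfolding jet_op_diff op[symmetric] using cases u u' that by auto
  qed (use assms x in auto)
  show "ennreal \<bar>u x - u' x\<bar> \<le> ?R"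
    using one_sided[of u u'] one_sided[of u' u] by (cases "u x \<le> u' x") (auto simp: insert_commute)
qed

end
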